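(* Let $n\ge 1$ be an integer, let $m$ be an integer with $\gcd(n,m)=1$, and let $q=e^{2\pi m i/n}$. Then $$1+2\sum_{k=1}^{n-1}q^{k}\binom{2k-1}{k}_q=\begin{cases}\left(\frac{m}{3}\right) i\sqrt{3} & \text{if } 3\mid n,\\[4pt] \left(\frac{n}{3}\right) & \text{otherwise.}\end{cases}$$
   Context: The Gaussian $q$-binomial coefficient $\binom{n}{k}_q$ is the polynomial in $q$ given by $\binom{n}{k}_q=\dfrac{(q;q)_n}{(q;q)_k(q;q)_{n-k}}$ if $0\le k\le n$ and $\binom{n}{k}_q=0$ otherwise, where $(z;q)_n=\prod_{j=0}^{n-1}(1-zq^j)$; at a root of unity it denotes the value of this polynomial. $\left(\frac{\cdot}{3}\right)$ is the Legendre symbol modulo $3$ (equal to $0,1,-1$ for arguments $\equiv 0,1,2 \pmod 3$ respectively). *)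

theory Defs
  imports
    "HOL-Analysis.Analysis"
    "HOL-Computational_Algebra.Polynomial"
    "HOL-Number_Theory.Number_Theory"
begin

definition q_pochhammer :: "'a::comm_ring_1 \<Rightarrow> 'a \<Rightarrow> nat \<Rightarrow> 'a" where
  "q_pochhammer z q n = (\<Prod>j<n. 1 - z * q ^ j)"

abbreviation q_fact_poly :: "nat \<Rightarrow> complex poly" where
  "q_fact_poly n \<equiv> q_pochhammer [:0, 1:] [:0, 1:] n"

(* The quotient is taken in the polynomial ring, where the division is exact by
   lemma q_binomial_mult below. The value at a root of unity is then that of
   poly (q_binomial n k), with no division by zero. *)
definition q_binomial :: "nat \<Rightarrow> nat \<Rightarrow> complex poly" where
  "q_binomial n k =
     (if k \<le> n then q_fact_poly n div (q_fact_poly k * q_fact_poly (n - k)) else 0)"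

lemma q_fact_poly_Suc:
  "q_fact_poly (Suc n) = q_fact_poly n * (1 - [:0, 1:] ^ Suc n)"
  by (simp add: q_pochhammer_def)

lemma q_fact_poly_dvd:
  "k \<le> n \<Longrightarrow> q_fact_poly k * q_fact_poly (n - k) dvd q_fact_poly n"
proof (induction n arbitrary: k)
  case 0
  then show ?case by (simp add: q_pochhammer_def)
next
  case (Suc n)
  show ?case
  proof (cases "k = 0 \<or> k = Suc n")
    case True
    then show ?thesis by (auto simp: q_pochhammer_def)
  next
    case False
    then obtain j where j: "k = Suc j" "j < n"
      using Suc.prems by (metis Suc_le_mono le_eq_less_or_eq not0_implies_Suc)
    define X :: "complex poly" where "X = [:0, 1:]"
    have nj: "n - j = Suc (n - k)" using j by simp
    have "X ^ Suc n = X ^ k * X ^ (n - j)"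
      using j by (simp flip: power_add power_Suc)
    then have "q_fact_poly (Suc n) =
        q_fact_poly n * (1 - X ^ k) + X ^ k * (q_fact_poly n * (1 - X ^ (n - j)))"
      unfolding q_fact_poly_Suc X_def by (simp add: algebra_simps del: power_Suc)
    moreover have "q_fact_poly k * q_fact_poly (Suc n - k) dvd q_fact_poly n * (1 - X ^ k)"
    proof -
      have "q_fact_poly k * q_fact_poly (Suc n - k) =
            (q_fact_poly j * q_fact_poly (n - j)) * (1 - X ^ k)"
        unfolding j(1) q_fact_poly_Suc X_def by simp
      then show ?thesis using Suc.IH [of j] j by (simp only: mult_dvd_mono dvd_refl less_imp_le)
    qed
    moreover have "q_fact_poly k * q_fact_poly (Suc n - k) dvd q_fact_poly n * (1 - X ^ (n - j))"
    proof -
      have "Suc n - k = Suc (n - k)" using j by simp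
      then have "q_fact_poly k * q_fact_poly (Suc n - k) =
            (q_fact_poly k * q_fact_poly (n - k)) * (1 - X ^ (n - j))"
        unfolding nj X_def using q_fact_poly_Suc [of "n - k"] by (simp only: mult.assoc)
      moreover have "k \<le> n" using j by simp
      ultimately show ?thesis using Suc.IH [of k] by (simp only: mult_dvd_mono dvd_refl)
    qed
    ultimately show ?thesis by simp
  qed
qed

lemma q_binomial_mult:
  "k \<le> n \<Longrightarrow> q_binomial n k * (q_fact_poly k * q_fact_poly (n - k)) = q_fact_poly n"
  using q_fact_poly_dvd [of k n] by (simp add: q_binomial_def)

end

theory Submission
  imports Defs
begin

text \<open>
  Put \<open>u\<^sub>0 = -1\<close>, \<open>u\<^sub>j\<^sub>+\<^sub>1 = - q\<^sup>j u\<^sub>j\<close> and let \<open>a\<^sub>j(N)\<close> be \<open>u\<^sub>j\<close> times the Gaussian binomial of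
  \<open>2 N - 1\<close> over \<open>N - j\<close>. The two Pascal rules turn into recurrences for \<open>a\<^sub>j\<close> whose coefficients
  are so simple that \<open>s\<^sub>j(N) = a\<^sub>j(N) + q\<^sup>j a\<^sub>j\<^sub>+\<^sub>1(N)\<close> satisfies
  \<open>s\<^sub>j(N + 1) - s\<^sub>j(N) = - q\<^sup>N (a\<^sub>j\<^sub>-\<^sub>1(N) + q\<^sup>j a\<^sub>j\<^sub>+\<^sub>2(N))\<close>. With weights \<open>w\<^sub>j\<^sub>+\<^sub>3 = - q\<^sup>j w\<^sub>j\<close> the
  sum over \<open>j\<close> of the right-hand sides telescopes, so the left-hand side of the theorem,
  with \<open>N\<close> in place of \<open>n\<close> and arbitrary \<open>q\<close>, equals \<open>\<Sum>j. w\<^sub>j s\<^sub>j(N)\<close>.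
  If \<open>q\<close> is a primitive root of unity of order \<open>n\<close>, then \<open>a\<^sub>1(n) = \<dots> = a\<^sub>n(n) = 1\<close>, and what
  remains is a sum over the weights, which are signed powers of \<open>q\<close> with pentagonal exponents.
\<close>

subsection \<open>Gaussian binomials with an integer lower argument\<close>

text \<open>An integer lower index lets both Pascal rules and the reflection k -> n - k hold past
  the ends of a row, without range conditions.\<close>

definition gauss :: "complex \<Rightarrow> nat \<Rightarrow> int \<Rightarrow> complex" where
  "gauss q n k = (if k < 0 then 0 else poly (q_binomial n (nat k)) q)"

lemma q_fact_poly_neq_0: "q_fact_poly n \<noteq> 0"
proof -
  have "poly (q_fact_poly n) 0 = 1"
    by (simp add: q_pochhammer_def poly_prod)
  then show ?thesis by force
qed

lemma q_binomial_0: "q_binomial n 0 = 1"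
  using q_binomial_mult [of 0 n] q_fact_poly_neq_0 [of n]
  by (simp add: q_pochhammer_def)

lemma q_binomial_sym: "k \<le> n \<Longrightarrow> q_binomial n (n - k) = q_binomial n k"
  by (simp add: q_binomial_def mult.commute)

lemma q_binomial_self: "q_binomial n n = 1"
  using q_binomial_sym [of 0 n] by (simp add: q_binomial_0)

text \<open>With n = k + l + 1, clearing denominators reduces the rule to 1 - X^(a+b) = (1 - X^a) +
  X^a (1 - X^b) for a = k + 1, b = l + 1; the q-factorials are nonzero and cancel.\<close>

lemma q_binomial_Suc_Suc:
  "q_binomial (Suc n) (Suc k) = q_binomial n k + [:0, 1:] ^ Suc k * q_binomial n (Suc k)"
proof -
  consider "n < k" | "n = k" | "k < n" by linarith
  then show ?thesis
  proof cases
    case 3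
    then obtain l where l: "n = Suc (k + l)"
      using less_iff_Suc_add by auto
    define X :: "complex poly" where "X = [:0, 1:]"
    define F where "F = q_fact_poly"
    have F: "F (Suc j) = F j * (1 - X ^ Suc j)" for j
      unfolding F_def X_def by (rule q_fact_poly_Suc)
    have 1: "q_binomial (Suc n) (Suc k) * (F (Suc k) * F (Suc l)) = F (Suc n)"
      using q_binomial_mult [of "Suc k" "Suc n"] l by (simp add: F_def)
    have 2: "q_binomial n k * (F k * F (Suc l)) = F n"
      using q_binomial_mult [of k n] l by (simp add: F_def Suc_diff_le)
    have 3: "q_binomial n (Suc k) * (F (Suc k) * F l) = F n"
      using q_binomial_mult [of "Suc k" n] l by (simp add: F_def)
    have "(q_binomial n k + X ^ Suc k * q_binomial n (Suc k)) * (F (Suc k) * F (Suc l))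
        = (q_binomial n k * (F k * F (Suc l))) * (1 - X ^ Suc k)
          + X ^ Suc k * (q_binomial n (Suc k) * (F (Suc k) * F l)) * (1 - X ^ Suc l)"
      unfolding F by (simp only: algebra_simps)
    also have "\<dots> = F n * (1 - X ^ (Suc k + Suc l))"
      unfolding 2 3 power_add by (simp add: algebra_simps del: power_Suc)
    also have "\<dots> = q_binomial (Suc n) (Suc k) * (F (Suc k) * F (Suc l))"
    proof -
      have "Suc k + Suc l = Suc n" using l by simp
      then show ?thesis unfolding 1 by (simp only: F)
    qed
    finally show ?thesis
      using q_fact_poly_neq_0 unfolding F_def X_def by simp
  next
    case 2
    then show ?thesis
      by (simp add: q_binomial_self) (simp add: q_binomial_def)
  qed (simp add: q_binomial_def)
qed

text \<open>The reflection of the first Pascal rule under the symmetry k -> n - k.\<close>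

lemma q_binomial_Suc_Suc':
  assumes "k \<le> n"
  shows "q_binomial (Suc n) (Suc k) = [:0, 1:] ^ (n - k) * q_binomial n k + q_binomial n (Suc k)"
proof (cases "k = n")
  case True
  then show ?thesis
    by (simp add: q_binomial_self) (simp add: q_binomial_def)
next
  case False
  then obtain l where l: "n = Suc (k + l)"
    using assms less_iff_Suc_add by (metis le_neq_implies_less)
  have "q_binomial (Suc n) (Suc k) = q_binomial (Suc n) (Suc l)"
    using q_binomial_sym [of "Suc k" "Suc n"] l by simp
  also have "\<dots> = q_binomial n l + [:0, 1:] ^ Suc l * q_binomial n (Suc l)"
    by (rule q_binomial_Suc_Suc)
  also have "q_binomial n l = q_binomial n (Suc k)"
    using q_binomial_sym [of "Suc k" n] l by simp
  also have "q_binomial n (Suc l) = q_binomial n k"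
    using q_binomial_sym [of k n] l by (simp add: Suc_diff_le)
  finally show ?thesis
    using l by (simp add: Suc_diff_le)
qed

lemma gauss_Suc:
  assumes "q \<noteq> 0"
  shows "gauss q (Suc n) k = gauss q n (k - 1) + q powi k * gauss q n k"
proof -
  consider "k < 0" | "k = 0" | j where "k = int (Suc j)"
    by (metis not_less_iff_gr_or_eq pos_int_cases gr0_implies_Suc)
  then show ?thesis
  proof cases
    case 3
    then have "nat k = Suc j" "nat (k - 1) = j" by simp_all
    then show ?thesis
      using 3 by (simp add: gauss_def q_binomial_Suc_Suc power_int_def)
  qed (simp_all add: gauss_def q_binomial_0)
qed

lemma gauss_Suc':
  assumes "q \<noteq> 0"
  shows "gauss q (Suc n) k = q powi (int n + 1 - k) * gauss q n (k - 1) + gauss q n k"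
proof -
  consider "k < 0" | "k = 0" | j where "k = int (Suc j)" "j \<le> n" | j where "k = int (Suc j)" "n < j"
    by (metis not_less_iff_gr_or_eq pos_int_cases gr0_implies_Suc not_le)
  then show ?thesis
  proof cases
    case 3
    then have "nat k = Suc j" "nat (k - 1) = j" and e: "int n + 1 - k = int (n - j)" by simp_all
    then show ?thesis
      unfolding e power_int_of_nat using 3 by (simp add: gauss_def q_binomial_Suc_Suc')
  next
    case 4
    then have "nat k = Suc j" "nat (k - 1) = j" by simp_all
    then show ?thesis
      using 4 by (simp add: gauss_def q_binomial_def)
  qed (simp_all add: gauss_def q_binomial_0)
qed

lemma gauss_sym: "gauss q n (int n - k) = gauss q n k"
proof -
  consider "k < 0" | "k > int n" | "0 \<le> k" "k \<le> int n" by linarith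
  then show ?thesis
  proof cases
    case 3
    then have "nat (int n - k) = n - nat k" "nat k \<le> n" by auto
    then show ?thesis
      using 3 by (simp add: gauss_def q_binomial_sym)
  qed (auto simp: gauss_def q_binomial_def)
qed

subsection \<open>A telescoping expansion\<close>

text \<open>In closed form \<open>(-1)^(j+1) q^(j(j-1)/2)\<close>. It absorbs the powers of q that
  two Pascal steps attach to the neighbours of an entry.\<close>

fun tri_sign :: "complex \<Rightarrow> nat \<Rightarrow> complex" where
  "tri_sign q 0 = - 1"
| "tri_sign q (Suc j) = - (q ^ j) * tri_sign q j"

text \<open>The parameter \<open>M\<close> is \<open>N - 1\<close>, which keeps \<open>2 N - 1\<close> free of truncated subtraction.\<close>

definition signed_gauss :: "complex \<Rightarrow> nat \<Rightarrow> nat \<Rightarrow> complex" where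
  "signed_gauss q M j = tri_sign q j * gauss q (2 * M + 1) (int M + 1 - int j)"

lemma signed_gauss_eq_0: "M + 1 < j \<Longrightarrow> signed_gauss q M j = 0"
  by (simp add: signed_gauss_def gauss_def)

text \<open>The two central entries of an odd row agree, while \<open>tri_sign\<close> takes the
  values -1 and 1 there. This produces the factor 2 of the theorem.\<close>

lemma signed_gauss_0: "signed_gauss q M 0 = - signed_gauss q M 1"
  using gauss_sym [of q "2 * M + 1" "int M"]
  by (simp add: signed_gauss_def algebra_simps)

lemma signed_gauss_top: "signed_gauss q M (Suc M) = tri_sign q (Suc M)"
  by (simp add: signed_gauss_def gauss_def q_binomial_0 del: tri_sign.simps)

text \<open>Both Pascal rules expand the same entry of row \<open>2 * M + 2\<close>; equating the
  two expansions gives the relation. It trades a factor \<open>q ^ (M + 1)\<close> for an exchange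
  of neighbours.\<close>

lemma signed_gauss_swap:
  assumes "q \<noteq> 0"
  shows "q ^ (M + 1) * (signed_gauss q M j + q ^ j * signed_gauss q M (Suc j)) =
         signed_gauss q M (Suc j) + q ^ j * signed_gauss q M j"
proof -
  define A where "A j = gauss q (2 * M + 1) (int M + 1 - int j)" for j
  have "A (Suc j) + q powi (int M + 1 - int j) * A j =
        q powi (int M + 1 + int j) * A (Suc j) + A j"
    using gauss_Suc [OF assms, of "2 * M + 1" "int M + 1 - int j"]
      gauss_Suc' [OF assms, of "2 * M + 1" "int M + 1 - int j"]
    by (simp add: A_def algebra_simps)
  also have "q powi (int M + 1 - int j) = q ^ (M + 1) / q ^ j"
    using assms by (simp add: power_int_diff power_int_add)
  also have "q powi (int M + 1 + int j) = q ^ (M + 1) * q ^ j"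
    using assms by (simp add: power_int_add)
  finally have "q ^ (M + 1) * (A j - q ^ j * q ^ j * A (Suc j)) = q ^ j * (A j - A (Suc j))"
    using assms by (simp add: field_simps)
  then have "tri_sign q j * (q ^ (M + 1) * (A j - q ^ j * q ^ j * A (Suc j))) =
      tri_sign q j * (q ^ j * (A j - A (Suc j)))"
    by simp
  then show ?thesis
    unfolding signed_gauss_def A_def by (simp add: algebra_simps)
qed

text \<open>Two Pascal steps lead from row \<open>2 * M + 1\<close> to row \<open>2 * M + 3\<close>.
  Using a different rule in each step leaves the middle entry with coefficient 1 + q^(2M+2).\<close>

lemma signed_gauss_Suc:
  assumes "q \<noteq> 0"
  shows "signed_gauss q (Suc M) (Suc j) - signed_gauss q M (Suc j) =
         q ^ (2 * M + 2) * signed_gauss q M (Suc j)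
         - q ^ (M + 1) * (signed_gauss q M j + signed_gauss q M (Suc (Suc j)))"
proof -
  define A where "A j = gauss q (2 * M + 1) (int M + 1 - int j)" for j
  have 1: "gauss q (2 * M + 2) (int M - int j) = q powi (int M + 2 + int j) * A (Suc (Suc j)) + A (Suc j)"
    using gauss_Suc' [OF assms, of "2 * M + 1" "int M - int j"]
    by (simp add: A_def algebra_simps)
  have 2: "gauss q (2 * M + 2) (int M + 1 - int j) = q powi (int M + 1 + int j) * A (Suc j) + A j"
    using gauss_Suc' [OF assms, of "2 * M + 1" "int M + 1 - int j"]
    by (simp add: A_def algebra_simps)
  have 3: "gauss q (2 * Suc M + 1) (int (Suc M) + 1 - int (Suc j)) =
      gauss q (2 * M + 2) (int M - int j) + q powi (int M + 1 - int j) * gauss q (2 * M + 2) (int M + 1 - int j)"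
    using gauss_Suc [OF assms, of "2 * M + 2" "int M + 1 - int j"]
    by (simp add: algebra_simps)
  have p: "q powi (int M + 1 - int j) = q ^ (M + 1) / q ^ j"
    "q powi (int M + 1 + int j) = q ^ (M + 1) * q ^ j"
    "q powi (int M + 2 + int j) = q ^ (M + 1) * q ^ Suc j"
    using assms by (simp_all add: power_int_diff power_int_add power2_eq_square)
  have main: "gauss q (2 * Suc M + 1) (int (Suc M) + 1 - int (Suc j)) =
      A (Suc j) + q ^ (M + 1) * q ^ Suc j * A (Suc (Suc j))
      + q ^ (M + 1) * q ^ (M + 1) * A (Suc j) + q ^ (M + 1) / q ^ j * A j"
    unfolding 3 2 1 p using assms by (simp add: field_simps)
  have sq: "q ^ (2 * M + 2) = q ^ (M + 1) * q ^ (M + 1)"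
    by (simp flip: power_add power_Suc add: mult_2)
  show ?thesis
    unfolding signed_gauss_def main sq A_def [symmetric] using assms
    by (simp add: field_simps)
qed

definition gauss_pair :: "complex \<Rightarrow> nat \<Rightarrow> nat \<Rightarrow> complex" where
  "gauss_pair q M j = signed_gauss q M j + q ^ j * signed_gauss q M (Suc j)"

text \<open>Two instances of \<open>signed_gauss_Suc\<close> leave a part quadratic in Q = q^(M+1).
  It is Q times the left side of \<open>signed_gauss_swap\<close>, hence linear in Q, and cancels
  all but the outer entries.\<close>

lemma gauss_pair_Suc:
  assumes "q \<noteq> 0"
  shows "gauss_pair q (Suc M) (Suc j) - gauss_pair q M (Suc j) =
    - (q ^ (M + 1)) * (signed_gauss q M j + q ^ Suc j * signed_gauss q M (j + 3))"
proof -
  define Q where "Q = q ^ (M + 1)"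
  define a where "a = signed_gauss q M"
  have QQ: "q ^ (2 * M + 2) = Q * Q"
    unfolding Q_def by (simp flip: power_add power_Suc add: mult_2)
  have *: "Q * (a (Suc j) + q ^ Suc j * a (Suc (Suc j))) = a (Suc (Suc j)) + q ^ Suc j * a (Suc j)"
    using signed_gauss_swap [OF assms, of M "Suc j"] unfolding Q_def a_def .
  have "gauss_pair q (Suc M) (Suc j) - gauss_pair q M (Suc j) =
      Q * (Q * (a (Suc j) + q ^ Suc j * a (Suc (Suc j))))
      - Q * (a j + a (Suc (Suc j)) + q ^ Suc j * (a (Suc j) + a (j + 3)))"
  proof -
    have "gauss_pair q (Suc M) (Suc j) - gauss_pair q M (Suc j) =
        (signed_gauss q (Suc M) (Suc j) - a (Suc j))
        + q ^ Suc j * (signed_gauss q (Suc M) (Suc (Suc j)) - a (Suc (Suc j)))"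
      by (simp add: gauss_pair_def a_def right_diff_distrib)
    then show ?thesis
      unfolding a_def signed_gauss_Suc [OF assms] QQ Q_def [symmetric]
      by (simp add: algebra_simps numeral_3_eq_3)
  qed
  also have "\<dots> = - Q * (a j + q ^ Suc j * a (j + 3))"
    unfolding * by (simp add: algebra_simps)
  finally show ?thesis
    unfolding Q_def a_def .
qed

text \<open>The terms of Euler's pentagonal series, separated by zeros. The recursion matches the
  gap of three between the indices in \<open>gauss_pair_Suc\<close>; the values at 1 and 2 fix the
  boundary term.\<close>

fun weight :: "complex \<Rightarrow> nat \<Rightarrow> complex" where
  "weight q 0 = 0"
| "weight q (Suc 0) = 1"
| "weight q (Suc (Suc 0)) = - 1"
| "weight q (Suc (Suc (Suc j))) = - (q ^ j) * weight q j"

text \<open>After a shift of the second part, the entry with index j + 2 has coefficient w(j+3) +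
  q^j w(j) = 0, so only the entries 0 and 1 survive.\<close>

lemma sum_weight_telescope:
  assumes "M \<le> K"
  shows "(\<Sum>j<K + 2. weight q (Suc j) * (signed_gauss q M j + q ^ Suc j * signed_gauss q M (j + 3)))
    = signed_gauss q M 0 - signed_gauss q M 1"
proof -
  define a where "a = signed_gauss q M"
  have z: "a j = 0" if "j \<ge> K + 2" for j
    using that assms by (simp add: a_def signed_gauss_eq_0)
  have "(\<Sum>j<K + 2. weight q (Suc j) * a j) = a 0 - a 1 + (\<Sum>j<K. weight q (j + 3) * a (j + 2))"
    by (simp add: sum.lessThan_Suc_shift numeral_3_eq_3 del: sum.lessThan_Suc weight.simps(4))
  also have "(\<Sum>j<K. weight q (j + 3) * a (j + 2)) = - (\<Sum>j<K. weight q j * q ^ j * a (j + 2))"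
    by (simp add: numeral_3_eq_3 sum_negf [symmetric] mult.commute)
  \<comment> \<open>The three added terms vanish because the entries are 0 from index K + 2 on; the
    next step drops j = 0 because \<open>weight q 0 = 0\<close>.\<close>
  also have "(\<Sum>j<K. weight q j * q ^ j * a (j + 2)) = (\<Sum>j<K + 3. weight q j * q ^ j * a (j + 2))"
    by (simp add: z numeral_3_eq_3)
  also have "\<dots> = (\<Sum>j<K + 2. weight q (Suc j) * q ^ Suc j * a (j + 3))"
    using sum.lessThan_Suc_shift [of "\<lambda>j. weight q j * q ^ j * a (j + 2)" "K + 2"]
    by (simp add: numeral_3_eq_3 del: sum.lessThan_Suc weight.simps(4) power_Suc)
  finally show ?thesis
    unfolding a_def [symmetric] by (simp add: distrib_left sum.distrib mult.assoc del: sum.lessThan_Suc)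
qed

text \<open>Induction on M with K fixed, so that the range of summation does not move; each step
  adds one summand of the right-hand side.\<close>

lemma sum_weight_gauss_pair:
  assumes "q \<noteq> 0" and "M \<le> K"
  shows "(\<Sum>j<K + 2. weight q (Suc j) * gauss_pair q M (Suc j)) =
    1 + 2 * (\<Sum>k=1..M. q ^ k * poly (q_binomial (2 * k - 1) k) q)"
  using assms(2)
proof (induction M)
  case 0
  have "(\<Sum>j<K + 2. weight q (Suc j) * gauss_pair q 0 (Suc j)) =
      gauss_pair q 0 1 + (\<Sum>j<Suc K. weight q (Suc (Suc j)) * gauss_pair q 0 (Suc (Suc j)))"
    by (simp add: sum.lessThan_Suc_shift del: sum.lessThan_Suc weight.simps(4))
  also have "\<dots> = gauss_pair q 0 1"
    by (simp add: gauss_pair_def signed_gauss_eq_0 del: sum.lessThan_Suc)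
  also have "\<dots> = 1"
    using signed_gauss_top [of q 0] by (simp add: gauss_pair_def signed_gauss_eq_0)
  finally show ?case by simp
next
  case (Suc M)
  have "(\<Sum>j<K + 2. weight q (Suc j) * gauss_pair q (Suc M) (Suc j))
      - (\<Sum>j<K + 2. weight q (Suc j) * gauss_pair q M (Suc j))
      = (\<Sum>j<K + 2. weight q (Suc j) * (gauss_pair q (Suc M) (Suc j) - gauss_pair q M (Suc j)))"
    by (simp only: right_diff_distrib sum_subtractf)
  also have "\<dots> = - (q ^ (M + 1)) * (\<Sum>j<K + 2. weight q (Suc j) *
      (signed_gauss q M j + q ^ Suc j * signed_gauss q M (j + 3)))"
    unfolding gauss_pair_Suc [OF assms(1)] sum_distrib_left
    by (simp only: mult.left_commute)
  also have "\<dots> = - (q ^ (M + 1)) * (2 * signed_gauss q M 0)"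
    using Suc.prems signed_gauss_0 [of q M] by (subst sum_weight_telescope) simp_all
  also have "\<dots> = 2 * (q ^ Suc M * poly (q_binomial (2 * Suc M - 1) (Suc M)) q)"
    by (simp add: signed_gauss_def gauss_def nat_add_distrib)
  finally show ?case
    using Suc by (simp add: algebra_simps)
qed

subsection \<open>Specialisation at a root of unity\<close>

text \<open>At such q, \<open>signed_gauss_swap\<close> reads (1 - q^j)(a(j) - a(j+1)) = 0, so the
  value at the top index spreads downwards.\<close>

lemma signed_gauss_root_of_unity:
  assumes "q ^ Suc M = 1" and "\<And>j. 0 < j \<Longrightarrow> j \<le> M \<Longrightarrow> q ^ j \<noteq> 1"
    and "1 \<le> j" and "j \<le> Suc M"
  shows "signed_gauss q M j = tri_sign q (Suc M)"
  using assms(4,3)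
proof (induction j rule: inc_induct)
  case base
  show ?case by (rule signed_gauss_top)
next
  case (step j)
  have "q \<noteq> 0" using assms(1) by auto
  then have "(1 - q ^ j) * (signed_gauss q M j - signed_gauss q M (Suc j)) = 0"
    using signed_gauss_swap [of q M j] assms(1) by (simp add: algebra_simps del: power_Suc)
  moreover have "q ^ j \<noteq> 1" using assms(2) step by auto
  ultimately show ?case using step by (simp del: tri_sign.simps)
qed

lemma sum_weight_root_of_unity:
  assumes "q ^ Suc M = 1" and "\<And>j. 0 < j \<Longrightarrow> j \<le> M \<Longrightarrow> q ^ j \<noteq> 1"
    and "tri_sign q (Suc M) = 1"
  shows "1 + 2 * (\<Sum>k=1..M. q ^ k * poly (q_binomial (2 * k - 1) k) q) =
    weight q (Suc M) + (\<Sum>j<Suc M. (1 + q ^ j) * weight q j)"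
proof -
  have "q \<noteq> 0" using assms(1) by auto
  then have "1 + 2 * (\<Sum>k=1..M. q ^ k * poly (q_binomial (2 * k - 1) k) q) =
      (\<Sum>j<M + 2. weight q (Suc j) * gauss_pair q M (Suc j))"
    by (rule sum_weight_gauss_pair [OF _ order_refl, symmetric])
  also have "\<dots> = weight q (Suc M) * gauss_pair q M (Suc M)
      + (\<Sum>j<M. weight q (Suc j) * gauss_pair q M (Suc j))"
    by (simp add: gauss_pair_def signed_gauss_eq_0 del: weight.simps(4))
  \<comment> \<open>The last pair lacks its second member, whose index exceeds M + 1; the earlier
    ones equal 1 + q^j.\<close>
  also have "gauss_pair q M (Suc M) = 1"
    using assms by (simp add: gauss_pair_def signed_gauss_eq_0 signed_gauss_top del: tri_sign.simps)
  also have "(\<Sum>j<M. weight q (Suc j) * gauss_pair q M (Suc j)) =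
      (\<Sum>j<M. (1 + q ^ Suc j) * weight q (Suc j))"
    using assms
    by (intro sum.cong) (simp_all add: gauss_pair_def signed_gauss_root_of_unity del: tri_sign.simps)
  also have "\<dots> = (\<Sum>j<Suc M. (1 + q ^ j) * weight q j)"
    by (simp add: sum.lessThan_Suc_shift del: sum.lessThan_Suc weight.simps(4))
  finally show ?thesis by simp
qed

section \<open>Closed forms over a square root of q\<close>

lemma tri_sign_square: "tri_sign (r\<^sup>2) (Suc j) = (- 1) ^ j * r ^ (j * Suc j)"
proof (induction j)
  case (Suc j)
  have "tri_sign (r\<^sup>2) (Suc (Suc j)) = - ((r\<^sup>2) ^ Suc j) * tri_sign (r\<^sup>2) (Suc j)"
    by (rule tri_sign.simps)
  also have "\<dots> = (- 1) ^ Suc j * r ^ (2 * Suc j + j * Suc j)"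
    unfolding Suc.IH power_add power_mult by simp
  also have "2 * Suc j + j * Suc j = Suc j * Suc (Suc j)" by simp
  finally show ?case .
qed simp

text \<open>The exponents of the weights are half-integral multiples of \<open>i\<close>, so a square root \<open>r\<close> of \<open>q\<close>
  removes the dependence on the parity of \<open>i\<close>.\<close>

lemma weight_square:
  fixes r :: complex
  assumes "r \<noteq> 0"
  shows "weight (r\<^sup>2) (3 * i) = 0"
    and "weight (r\<^sup>2) (3 * i + 1) = (- 1) ^ i * r ^ (3 * i\<^sup>2) / r ^ i"
    and "weight (r\<^sup>2) (3 * i + 2) = - ((- 1) ^ i * r ^ (3 * i\<^sup>2) * r ^ i)"
proof (induction i)
  case (Suc i)
  define R where "R = r ^ i"
  define G where "G = r ^ (3 * i\<^sup>2)"
  have "R \<noteq> 0" using assms by (simp add: R_def)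
  have e: "r ^ (3 * (Suc i)\<^sup>2) = r ^ (3 * i\<^sup>2) * r ^ (6 * i) * r ^ 3"
    by (simp flip: power_add add: power2_eq_square algebra_simps)
  have r6: "r ^ (6 * i) = (r ^ i) ^ 6"
    by (simp add: power_mult mult.commute flip: power_mult)
  have q3: "(r\<^sup>2) ^ (3 * i) = (r ^ i) ^ 6"
    by (simp flip: power_mult add: mult.commute)
  have s: "3 * Suc i = Suc (Suc (Suc (3 * i)))" "3 * Suc i + 1 = Suc (Suc (Suc (3 * i + 1)))"
    "3 * Suc i + 2 = Suc (Suc (Suc (3 * i + 2)))" by simp_all
  {
    case 1
    show ?case unfolding s(1) weight.simps using Suc.IH(1) by simp
  next
    case 2
    show ?case unfolding s(2) weight.simps Suc.IH(2) e r6 power_add q3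
      unfolding power_Suc R_def [symmetric] G_def [symmetric]
      using assms \<open>R \<noteq> 0\<close> by (simp add: field_simps eval_nat_numeral)
  next
    case 3
    show ?case unfolding s(3) weight.simps Suc.IH(3) e r6 power_add q3
      unfolding power_Suc R_def [symmetric] G_def [symmetric]
      using assms \<open>R \<noteq> 0\<close> by (simp add: field_simps eval_nat_numeral)
  }
qed simp_all

text \<open>Behind the closed form: (1 + q^j) w(j) = w(j) - w(j+3) and w(0) + w(1) + w(2) = 0, so
  the sum is minus the next three weights.\<close>

lemma sum_weight_square:
  fixes r :: complex
  assumes "r \<noteq> 0"
  shows "(\<Sum>j<3 * i. (1 + (r\<^sup>2) ^ j) * weight (r\<^sup>2) j) = (- 1) ^ i * r ^ (3 * i\<^sup>2) * (r ^ i - 1 / r ^ i)"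
proof (induction i)
  case (Suc i)
  define R where "R = r ^ i"
  define G where "G = r ^ (3 * i\<^sup>2)"
  have "R \<noteq> 0" using assms by (simp add: R_def)
  have e: "r ^ (3 * (Suc i)\<^sup>2) = r ^ (3 * i\<^sup>2) * r ^ (6 * i) * r ^ 3"
    by (simp flip: power_add add: power2_eq_square algebra_simps)
  have r6: "r ^ (6 * i) = (r ^ i) ^ 6"
    by (simp add: power_mult mult.commute flip: power_mult)
  have q3: "(r\<^sup>2) ^ (3 * i) = (r ^ i) ^ 6"
    by (simp flip: power_mult add: mult.commute)
  have s: "3 * Suc i = Suc (Suc (Suc (3 * i)))" by simp
  have "(\<Sum>j<3 * Suc i. (1 + (r\<^sup>2) ^ j) * weight (r\<^sup>2) j) =
      (\<Sum>j<3 * i. (1 + (r\<^sup>2) ^ j) * weight (r\<^sup>2) j)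
      + (1 + (r\<^sup>2) ^ (3 * i + 1)) * weight (r\<^sup>2) (3 * i + 1)
      + (1 + (r\<^sup>2) ^ (3 * i + 2)) * weight (r\<^sup>2) (3 * i + 2)"
    unfolding s sum.lessThan_Suc using weight_square(1) [OF assms, of i] by simp
  also have "\<dots> = (- 1) ^ Suc i * r ^ (3 * (Suc i)\<^sup>2) * (r ^ Suc i - 1 / r ^ Suc i)"
    unfolding Suc.IH weight_square(2,3) [OF assms] e r6 power_add q3
    unfolding power_Suc R_def [symmetric] G_def [symmetric]
    using assms \<open>R \<noteq> 0\<close> by (simp add: field_simps eval_nat_numeral)
  finally show ?case .
qed simp

text \<open>By the same telescoping the left side is -(w(n+1) + w(n+2)). In each residue class the
  exponent of r is reduced by r^n = \<epsilon>, and the assumption on \<epsilon> settles the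
  remaining power of -\<epsilon> by parity.\<close>

lemma weight_sum_square:
  fixes r \<epsilon> :: complex
  assumes "r \<noteq> 0" and "r ^ n = \<epsilon>" and "\<epsilon> = 1 \<and> odd n \<or> \<epsilon> = - 1"
  shows "weight (r\<^sup>2) n + (\<Sum>j<n. (1 + (r\<^sup>2) ^ j) * weight (r\<^sup>2) j) =
    (if n mod 3 = 0 then - \<epsilon> * (r ^ (n div 3) - 1 / r ^ (n div 3))
     else if n mod 3 = 1 then 1 else - 1)"
proof -
  define i where "i = n div 3"
  consider "n = 3 * i" | "n = 3 * i + 1" | "n = 3 * i + 2"
    unfolding i_def by linarith
  then show ?thesis
  proof cases
    case 1
    have "3 * i\<^sup>2 = n * i" by (simp add: 1 power2_eq_square)
    then have "r ^ (3 * i\<^sup>2) = \<epsilon> ^ i"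
      by (simp only: power_mult assms(2))
    then have "(- 1) ^ i * r ^ (3 * i\<^sup>2) = (- \<epsilon>) ^ i"
      by (simp add: power_minus [of \<epsilon>])
    moreover have "(- \<epsilon>) ^ i = - \<epsilon>"
      using assms(3) 1 by auto
    ultimately show ?thesis
      using weight_square(1) [OF assms(1), of i] sum_weight_square [OF assms(1), of i] 1 by simp
  next
    case 2
    have "3 * i\<^sup>2 + i = n * i" by (simp add: 2 power2_eq_square algebra_simps)
    then have "r ^ (3 * i\<^sup>2) * r ^ i = \<epsilon> ^ i"
      by (metis assms(2) power_add power_mult)
    then have "(- 1) ^ i * (r ^ (3 * i\<^sup>2) * r ^ i) = (- \<epsilon>) ^ i"
      by (simp add: power_minus [of \<epsilon>])
    moreover have "(- \<epsilon>) ^ i = 1"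
      using assms(3) 2 by auto
    moreover have "(\<Sum>j<n. (1 + (r\<^sup>2) ^ j) * weight (r\<^sup>2) j) =
        (- 1) ^ i * r ^ (3 * i\<^sup>2) * (r ^ i - 1 / r ^ i)"
      using weight_square(1) [OF assms(1), of i] sum_weight_square [OF assms(1), of i] 2 by simp
    moreover have "weight (r\<^sup>2) n = (- 1) ^ i * r ^ (3 * i\<^sup>2) / r ^ i"
      using weight_square(2) [OF assms(1), of i] 2 by simp
    moreover have "n mod 3 = 1" using 2 by simp
    ultimately show ?thesis
      by (simp add: right_diff_distrib mult.assoc)
  next
    case 3
    \<comment> \<open>The exponent 5i + 2 = 2(3i + 1) - i comes from q^(3i+1) / r^i, the only term
      left after the cancellation below.\<close>
    have "3 * i\<^sup>2 + (5 * i + 2) = n * (i + 1)" by (simp add: 3 power2_eq_square algebra_simps)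
    then have "r ^ (3 * i\<^sup>2) * r ^ (5 * i + 2) = \<epsilon> ^ (i + 1)"
      by (metis assms(2) power_add power_mult)
    then have 4: "(- 1) ^ i * (r ^ (3 * i\<^sup>2) * r ^ (5 * i + 2)) = - ((- \<epsilon>) ^ (i + 1))"
      by (simp add: power_minus [of \<epsilon>])
    have 5: "(- \<epsilon>) ^ (i + 1) = 1"
      using assms(3) 3 by auto
    have "(r\<^sup>2) ^ (3 * i + 1) = r ^ (5 * i + 2) * r ^ i"
      by (simp flip: power_mult power_add)
    then have 6: "(r\<^sup>2) ^ (3 * i + 1) / r ^ i = r ^ (5 * i + 2)"
      using assms(1) by simp
    have 7: "- (S * R) + (S * (R - 1 / R) + (1 + Q) * (S / R)) = S * (Q / R)" for S R Q :: complex
      by (simp add: algebra_simps add_divide_distrib)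
    have 8: "(\<Sum>j<n. (1 + (r\<^sup>2) ^ j) * weight (r\<^sup>2) j) =
        (- 1) ^ i * r ^ (3 * i\<^sup>2) * (r ^ i - 1 / r ^ i)
        + (1 + (r\<^sup>2) ^ (3 * i + 1)) * ((- 1) ^ i * r ^ (3 * i\<^sup>2) / r ^ i)"
      using weight_square(1,2) [OF assms(1), of i] sum_weight_square [OF assms(1), of i] 3
      by simp
    have 9: "weight (r\<^sup>2) n = - ((- 1) ^ i * r ^ (3 * i\<^sup>2) * r ^ i)"
      using weight_square(3) [OF assms(1), of i] 3 by simp
    have "weight (r\<^sup>2) n + (\<Sum>j<n. (1 + (r\<^sup>2) ^ j) * weight (r\<^sup>2) j) = - 1"
      unfolding 8 9 7 unfolding 6 mult.assoc unfolding 4 5 ..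
    moreover have "n mod 3 = 2" using 3 by presburger
    ultimately show ?thesis by simp
  qed
qed

section \<open>The Legendre symbol modulo 3 and sines of multiples of pi / 3\<close>

lemma Legendre_3: "Legendre a 3 = (if a mod 3 = 0 then 0 else if a mod 3 = 1 then 1 else - 1)"
proof -
  have "QuadRes 3 a" if "a mod 3 = 1"
    unfolding QuadRes_def cong_def using that by (intro exI [of _ 1]) simp
  moreover have "a mod 3 = 1" if a: "QuadRes 3 a" "a mod 3 \<noteq> 0"
  proof -
    obtain y :: int where y: "y\<^sup>2 mod 3 = a mod 3"
      using a(1) unfolding QuadRes_def cong_def by blast
    have "y mod 3 = 0 \<or> y mod 3 = 1 \<or> y mod 3 = 2" by presburger
    moreover have "y\<^sup>2 mod 3 = (y mod 3)\<^sup>2 mod 3" by (simp add: power_mod)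
    ultimately show ?thesis using y a(2) by auto
  qed
  ultimately show ?thesis
    by (auto simp: Legendre_def cong_def)
qed

text \<open>The difference is 2i sin(pi m / 3), of period 6 in m. Replacing m by m + 3 flips both
  the sine and the parity sign, so the product depends on m modulo 3 only.\<close>

lemma exp_pi_third_diff:
  fixes m :: int
  assumes "r = exp (complex_of_real pi * of_int m * \<i> / 3)"
  shows "(if even m then - 1 else 1) * (r - 1 / r) = of_int (Legendre m 3) * \<i> * complex_of_real (sqrt 3)"
proof -
  define \<theta> where "\<theta> = pi * of_int m / 3"
  have r: "r = cis \<theta>"
    unfolding assms \<theta>_def cis_conv_exp by (simp add: mult.commute mult.left_commute)
  have "r - 1 / r = 2 * \<i> * complex_of_real (sin \<theta>)"
    unfolding r by (simp add: complex_eq_iff flip: inverse_eq_divide)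
  moreover have "2 * (if even m then - 1 else 1) * sin \<theta> = real_of_int (Legendre m 3) * sqrt 3"
  proof -
    define k where "k = m div 6"
    define c where "c = m mod 6"
    have m: "m = 6 * k + c" by (simp add: k_def c_def)
    have "\<theta> = pi * of_int c / 3 + 2 * pi * of_int k"
      by (simp add: \<theta>_def m field_simps)
    then have s: "sin \<theta> = sin (pi * of_int c / 3)"
      by (simp add: sin_add)
    have s1: "sin (pi / 3) = sqrt 3 / 2" by (simp add: sin_60)
    have "pi * 2 / 3 = pi - pi / 3" by simp
    then have s2: "sin (pi * 2 / 3) = sqrt 3 / 2" by (simp only: sin_pi_minus s1)
    have "pi * 4 / 3 = pi / 3 + pi" by simp
    then have s4: "sin (pi * 4 / 3) = - (sqrt 3 / 2)" by (simp only: sin_periodic_pi s1)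
    have "pi * 5 / 3 = pi * 2 / 3 + pi" by simp
    then have s5: "sin (pi * 5 / 3) = - (sqrt 3 / 2)" by (simp only: sin_periodic_pi s2)
    have "c \<in> {0, 1, 2, 3, 4, 5}" unfolding c_def by simp presburger
    moreover have "m mod 3 = c mod 3" "even m \<longleftrightarrow> even c"
      unfolding m by presburger+
    ultimately show ?thesis
      unfolding s Legendre_3 by (auto simp: s1 s2 s4 s5)
  qed
  then have "complex_of_real (2 * (if even m then - 1 else 1) * sin \<theta>) =
      complex_of_real (real_of_int (Legendre m 3) * sqrt 3)"
    by simp
  ultimately show ?thesis by (auto split: if_splits)
qed

theorem theorem5p1:
  fixes n :: nat and m :: int and q :: complex
  assumes "n \<ge> 1"
    and "gcd (int n) m = 1"
    and "q = exp (2 * complex_of_real pi * of_int m * \<i> / of_nat n)"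
  shows "1 + 2 * (\<Sum>k=1..n-1. q ^ k * poly (q_binomial (2 * k - 1) k) q) =
    (if 3 dvd n then of_int (Legendre m 3) * \<i> * complex_of_real (sqrt 3)
     else of_int (Legendre (int n) 3))"
proof -
  \<comment> \<open>This square root of q satisfies r^n = (-1)^m, which is \<epsilon>.\<close>
  define r where "r = exp (complex_of_real pi * of_int m * \<i> / of_nat n)"
  define \<epsilon> :: complex where "\<epsilon> = (if even m then 1 else - 1)"
  obtain M where n: "n = Suc M" using assms(1) by (cases n) auto
  have r0: "r \<noteq> 0" by (simp add: r_def)
  have q: "q = r\<^sup>2"
    unfolding assms(3) r_def exp_double [symmetric] by (simp add: field_simps)
  have "r ^ n = exp (complex_of_real (pi * of_int m) * \<i>)"
    unfolding r_def exp_of_nat_mult [symmetric] using assms(1) by simp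
  also have "\<dots> = cis (pi * of_int m)"
    by (simp add: cis_conv_exp mult.commute)
  also have "\<dots> = \<epsilon>"
    by (auto simp: \<epsilon>_def complex_eq_iff cos_int_times_real)
  finally have rn: "r ^ n = \<epsilon>" .
  \<comment> \<open>By coprimality n and m are not both even, so \<epsilon> = 1 forces n odd, as
    \<open>weight_sum_square\<close> requires.\<close>
  have parity: "odd n" if "even m"
  proof
    assume "even n"
    then have "2 dvd gcd (int n) m" using that by simp
    then show False using assms(2) by simp
  qed
  have "q ^ n = 1"
    unfolding q using rn by (simp add: \<epsilon>_def mult.commute flip: power_mult) (simp add: power_mult)
  moreover have "q ^ j \<noteq> 1" if "0 < j" "j \<le> M" for j
  proof
    assume "q ^ j = 1"
    then have "exp (complex_of_real (2 * pi * of_int m * real j / real n) * \<i>) = 1"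
      unfolding assms(3) exp_of_nat_mult [symmetric] by (simp add: field_simps)
    then obtain k :: int where "2 * pi * of_int m * real j / real n = of_int (2 * k) * pi"
      by (auto simp: exp_eq_1)
    then have "pi * (of_int m * real j) = pi * (of_int k * real n)"
      using assms(1) by (simp add: field_simps)
    then have "real_of_int (m * int j) = real_of_int (k * int n)"
      by simp
    then have "int n dvd m * int j"
      by (simp only: of_int_eq_iff dvd_triv_right)
    then have "int n dvd int j"
      using assms(2) by (simp add: coprime_iff_gcd_eq_1 coprime_dvd_mult_right_iff)
    then have "n dvd j" by simp
    then show False using that n by (auto dest: dvd_imp_le)
  qed
  moreover have "tri_sign q n = 1"
  proof -
    \<comment> \<open>The exponent of r is M(M + 1) = M n, hence a power of r^n. For even m, M = n -
      1 is even; for odd m, -\<epsilon> = 1.\<close>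
    have "tri_sign q n = (- 1) ^ M * \<epsilon> ^ M"
      unfolding q n tri_sign_square mult.commute [of M] power_mult rn [unfolded n] ..
    also have "\<dots> = (- \<epsilon>) ^ M"
      by (simp flip: power_mult_distrib)
    also have "\<dots> = 1"
      using parity n by (cases "even m") (simp_all add: \<epsilon>_def)
    finally show ?thesis .
  qed
  ultimately have "1 + 2 * (\<Sum>k=1..n-1. q ^ k * poly (q_binomial (2 * k - 1) k) q) =
      weight q n + (\<Sum>j<n. (1 + q ^ j) * weight q j)"
    unfolding n using sum_weight_root_of_unity [of q M] by simp
  also have "\<dots> = (if n mod 3 = 0 then - \<epsilon> * (r ^ (n div 3) - 1 / r ^ (n div 3))
      else if n mod 3 = 1 then 1 else - 1)"
    unfolding q using r0 rn parity by (intro weight_sum_square) (auto simp: \<epsilon>_def)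
  also have "\<dots> = (if 3 dvd n then of_int (Legendre m 3) * \<i> * complex_of_real (sqrt 3)
      else of_int (Legendre (int n) 3))"
  proof (cases "3 dvd n")
    case True
    then obtain i where i: "n = 3 * i" ..
    have "r ^ i = exp (complex_of_real pi * of_int m * \<i> / 3)"
      unfolding r_def exp_of_nat_mult [symmetric] using assms(1) i by (simp add: field_simps)
    from exp_pi_third_diff [OF this] show ?thesis
      using i by (simp add: \<epsilon>_def split: if_splits)
  next
    case False
    then have "int n mod 3 = int (n mod 3)" "n mod 3 = 1 \<or> n mod 3 = 2"
      by (simp_all add: zmod_int) presburger
    then show ?thesis using False unfolding Legendre_3 by auto
  qed
  finally show ?thesis .
qed

end
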